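(* Let $W$ be a set and let $F:\mathscr P(W)\to\mathscr P(W)$ satisfy, for all $X,Y\subseteq W$: $F(X)\subseteq X$; if $X\neq\emptyset$ then $F(X)\neq\emptyset$; and $F(X\cap Y)=F(X)\cap Y$ whenever $F(X)\cap Y\neq\emptyset$. Define $\mathrm{ob}:\mathscr P(W)\to\mathscr P(\mathscr P(W))$ by $\mathrm{ob}(X)=\{Y\subseteq W: Y\cap X=F(X)\}$. Then $\mathrm{ob}$ satisfies: for all $X,Y,Z\subseteq W$, if $Y\subseteq X$, $Z\in\mathrm{ob}(X)$ and $Y\cap Z\neq\emptyset$, then $Z\in\mathrm{ob}(Y)$.
   Context: $F(X)$ is interpreted as the set of ideal worlds in context $X$. The conclusion is Carmo and Jones' condition 5(e). *)

theory Defs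
  imports Main "HOL-Library.FuncSet"
begin

definition ob :: "'a set \<Rightarrow> ('a set \<Rightarrow> 'a set) \<Rightarrow> 'a set \<Rightarrow> 'a set set" where
  "ob W F X = {Y. Y \<subseteq> W \<and> Y \<inter> X = F X}"

end

theory Submission
  imports Defs
begin

text \<open>Membership of \<open>Z\<close> in \<open>ob W F X\<close> says that \<open>Z\<close>
  cuts \<open>X\<close> exactly in its ideal worlds. Intersecting with
  \<open>Y \<subseteq> X\<close> shows that \<open>Z\<close> cuts \<open>Y\<close> in
  \<open>F X \<inter> Y\<close>. As this is nonempty, the restriction law for \<open>F\<close>
  identifies it with \<open>F Y\<close>.\<close>

theorem theorem3:
  fixes W :: "'a set" and F :: "'a set \<Rightarrow> 'a set"
  assumes "F \<in> Pow W \<rightarrow> Pow W"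
    and "\<And>X. X \<subseteq> W \<Longrightarrow> F X \<subseteq> X"
    and "\<And>X. X \<subseteq> W \<Longrightarrow> X \<noteq> {} \<Longrightarrow> F X \<noteq> {}"
    and "\<And>X Y. X \<subseteq> W \<Longrightarrow> Y \<subseteq> W \<Longrightarrow> F X \<inter> Y \<noteq> {} \<Longrightarrow> F (X \<inter> Y) = F X \<inter> Y"
  shows "\<forall>X Y Z. X \<subseteq> W \<longrightarrow> Y \<subseteq> W \<longrightarrow> Z \<subseteq> W \<longrightarrow>
    Y \<subseteq> X \<longrightarrow> Z \<in> ob W F X \<longrightarrow> Y \<inter> Z \<noteq> {} \<longrightarrow> Z \<in> ob W F Y"
proof (intro allI impI)
  fix X Y Z
  assume sub: "X \<subseteq> W" "Y \<subseteq> W" "Z \<subseteq> W" "Y \<subseteq> X"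
    and Z: "Z \<in> ob W F X" and ne: "Y \<inter> Z \<noteq> {}"
  have FX: "F X \<inter> Y = Z \<inter> Y"
    using Z sub by (auto simp: ob_def)
  \<comment> \<open>Since \<open>Y \<subseteq> X\<close>, the context \<open>Y\<close> is the
    restriction of \<open>X\<close> to \<open>Y\<close>, the form that \<open>assms(4)\<close>
    treats.\<close>
  have "F Y = F (X \<inter> Y)"
    using sub by (simp add: Int_absorb1)
  \<comment> \<open>\<open>FX\<close> turns \<open>ne\<close> into the side condition
    \<open>F X \<inter> Y \<noteq> {}\<close> of \<open>assms(4)\<close>.\<close>
  also have "\<dots> = F X \<inter> Y"
    using assms(4) sub FX ne by (metis Int_commute)
  finally show "Z \<in> ob W F Y"
    using FX sub by (simp add: ob_def)
qed

end
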